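(* Let $k$ be a positive integer and $\epsilon>0$. If $n$ is an integer with $n \geq (16/\epsilon)^{2k+1}$, then every $2$-edge-coloring of the complete graph $K_n$ with at least $\epsilon\binom{n}{2}$ edges in each color contains a member of $\mathcal{F}_k$.
   Context: $\mathcal{F}_k$ denotes the family of $2$-edge-colored complete graphs on $2k$ vertices in which one of the two colors forms either a clique of order $k$ or two disjoint cliques of order $k$ (that is, the edges of that color are exactly the edges of a complete graph on some $k$ of the $2k$ vertices, or exactly the edges of two complete graphs on complementary sets of $k$ vertices each; all other edges have the other color). A $2$-edge-coloring of $K_n$ contains a member of $\mathcal{F}_k$ if there are $2k$ vertices on which the induced $2$-edge-colored complete graph is a member of $\mathcal{F}_k$.
   Formalization: The formal theorem assumes n ≥ 2; for n = 1 and ε ≥ 16 the claim as written is false, since K_1 has no edges (so the density condition is vacuous) and fewer than 2k vertices. No other case is excluded. *)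

theory Defs
  imports Complex_Main "HOL-Library.Ramsey"
begin

text \<open>
  The edge set of the complete graph on a vertex set \<open>V\<close> is \<open>[V]\<^bsup>2\<^esup>\<close>, the set of all 2-element
  subsets of \<open>V\<close>. A 2-edge-coloring is a function \<open>c\<close> from edges to \<open>bool\<close>, the two truth values
  being the two colors; the values of \<open>c\<close> on sets that are not edges are never inspected, so
  restricting \<open>V\<close> to a subset \<open>W\<close> while keeping \<open>c\<close> gives the induced coloring on \<open>W\<close>.
\<close>

definition color_class :: "('a set \<Rightarrow> bool) \<Rightarrow> bool \<Rightarrow> 'a set \<Rightarrow> 'a set set" where
  "color_class c i V = {e \<in> [V]\<^bsup>2\<^esup>. c e = i}"

definition in_family :: "nat \<Rightarrow> 'a set \<Rightarrow> ('a set \<Rightarrow> bool) \<Rightarrow> bool" where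
  "in_family k W c \<longleftrightarrow>
     finite W \<and> card W = 2 * k \<and>
     (\<exists>i. \<exists>A \<subseteq> W. card A = k \<and>
        (color_class c i W = [A]\<^bsup>2\<^esup> \<or> color_class c i W = [A]\<^bsup>2\<^esup> \<union> [W - A]\<^bsup>2\<^esup>))"

definition contains_member :: "nat \<Rightarrow> 'a set \<Rightarrow> ('a set \<Rightarrow> bool) \<Rightarrow> bool" where
  "contains_member k V c \<longleftrightarrow> (\<exists>W \<subseteq> V. in_family k W c)"

end

theory Submission
  imports Defs
begin

text \<open>
  It suffices to find monochromatic \<open>k\<close>-cliques \<open>X\<close>, \<open>Y\<close> and a set of at least \<open>4 ^ (k - 1)\<close> vertices
  joined to \<open>Y\<close> entirely in some color \<open>i\<close> and to \<open>X\<close> entirely in the other color: by Ramsey's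
  theorem that set contains a monochromatic \<open>k\<close>-clique \<open>K\<close>, which forms a member of the family
  together with \<open>X\<close> if \<open>K\<close> has color \<open>i\<close>, and together with \<open>Y\<close> otherwise.

  For some \<open>i\<close> there are at least \<open>\<epsilon>n/8\<close> vertices whose degree in color \<open>i\<close> lies between \<open>\<epsilon>n/8\<close> and
  \<open>n/2\<close>. Let \<open>Q\<close> be the set of these. Dependent random choice from \<open>Q\<close>, in the other color, yields a
  large set of vertices in which every \<open>k\<close>-subset has at least \<open>card Q / 4 ^ k\<close> common neighbors in
  \<open>Q\<close>; it contains a clique \<open>X\<close>. Because every vertex of \<open>Q\<close> has degree at least \<open>\<epsilon>n/8\<close> in color
  \<open>i\<close>, passing to the common neighbors of \<open>X\<close> does not reduce the density in color \<open>i\<close>, and a second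
  dependent random choice there, with samples of size \<open>2k\<close>, yields \<open>Y\<close>.
\<close>

section \<open>Neighborhoods in one color and Ramsey's theorem\<close>

text \<open>Without \<open>x \<noteq> v\<close>, the value of \<open>c\<close> on the singleton
  \<open>{v, v}\<close>, which is no edge, would count.\<close>

definition nbhd :: "('a set \<Rightarrow> bool) \<Rightarrow> 'a set \<Rightarrow> bool \<Rightarrow> 'a \<Rightarrow> 'a set" where
  "nbhd c V i v = {x \<in> V. x \<noteq> v \<and> c {v, x} = i}"

lemma finite_nbhd [simp]: "finite V \<Longrightarrow> finite (nbhd c V i v)"
  by (simp add: nbhd_def)

lemma nbhd_subset: "nbhd c V i v \<subseteq> V"
  by (auto simp: nbhd_def)

lemma card_nbhd_add:
  assumes "finite V" "v \<in> V"
  shows "card (nbhd c V i v) + card (nbhd c V (\<not> i) v) + 1 = card V"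
proof -
  have "V = insert v (nbhd c V i v \<union> nbhd c V (\<not> i) v)"
    using assms by (auto simp: nbhd_def)
  moreover have "card (insert v (nbhd c V i v \<union> nbhd c V (\<not> i) v))
      = Suc (card (nbhd c V i v) + card (nbhd c V (\<not> i) v))"
    using assms by (subst card_insert_disjoint) (auto simp: nbhd_def intro!: card_Un_disjoint)
  ultimately show ?thesis by simp
qed

definition color_clique :: "('a set \<Rightarrow> bool) \<Rightarrow> bool \<Rightarrow> 'a set \<Rightarrow> bool" where
  "color_clique c i A \<longleftrightarrow> (\<forall>x\<in>A. \<forall>y\<in>A. x \<noteq> y \<longrightarrow> c {x, y} = i)"

lemma color_clique_insert_nbhd:
  assumes "color_clique c i A" "A \<subseteq> nbhd c V i v"
  shows "color_clique c i (insert v A)"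
  using assms by (auto simp: color_clique_def nbhd_def insert_commute)

text \<open>Around any vertex some color reaches about half of the others; passing to that
  neighborhood lowers the demand in that color by one. As \<open>f i\<close> is the clique size
  minus one, demand zero is met by a single vertex.\<close>

lemma ramsey_two_power_aux:
  assumes "finite V" "2 ^ (f True + f False) \<le> card V"
  shows "\<exists>i. \<exists>A\<subseteq>V. card A = Suc (f i) \<and> color_clique c i A"
  using assms
proof (induction "f True + f False" arbitrary: f V)
  case (0 f V)
  then have "V \<noteq> {}" by auto
  then obtain v where "v \<in> V" by blast
  then show ?case
    using 0 by (intro exI[of _ True] exI[of _ "{v}"]) (auto simp: color_clique_def)
next
  case (Suc m f V)
  then have "V \<noteq> {}" by auto
  then obtain v where v: "v \<in> V" by blast
  show ?case
  proof (cases "\<exists>i. f i = 0")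
    case True
    then obtain i where "f i = 0" by blast
    then show ?thesis
      using v by (intro exI[of _ i] exI[of _ "{v}"]) (auto simp: color_clique_def)
  next
    case False
    have "2 * 2 ^ m \<le> card V" using Suc.prems(2) Suc.hyps(2) by (metis power_Suc)
    then obtain i where i: "2 ^ m \<le> card (nbhd c V i v)"
    proof -
      \<comment> \<open>The two degrees sum to at least \<open>2 * 2 ^ m - 1\<close>, so they cannot
        both be at most \<open>2 ^ m - 1\<close>.\<close>
      have "2 ^ m \<le> card (nbhd c V True v) \<or> 2 ^ m \<le> card (nbhd c V False v)"
        using card_nbhd_add[OF Suc.prems(1) v, of c True] \<open>2 * 2 ^ m \<le> card V\<close> by simp linarith
      then show thesis using that by blast
    qed
    obtain b where b: "f i = Suc b" using False not0_implies_Suc by blast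
    define g where "g = f(i := b)"
    have g: "m = g True + g False"
      using b Suc.hyps(2) unfolding g_def by (cases i) auto
    from Suc.hyps(1)[OF this, of "nbhd c V i v"] i g Suc.prems(1)
    obtain j A where A: "A \<subseteq> nbhd c V i v" "card A = Suc (g j)" "color_clique c j A" by auto
    show ?thesis
    proof (cases "j = i")
      case True
      have "v \<notin> A" "finite A" using A(1) Suc.prems(1) by (auto simp: nbhd_def intro: finite_subset)
      then show ?thesis
        using A v True b color_clique_insert_nbhd[of c i A V v] nbhd_subset[of c V i v]
        by (intro exI[of _ i] exI[of _ "insert v A"]) (auto simp: g_def)
    next
      case False
      then show ?thesis
        using A nbhd_subset[of c V i v]
        by (intro exI[of _ j] exI[of _ A]) (auto simp: g_def)
    qed
  qed
qed

lemma ramsey_diagonal: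
  assumes "finite V" "k > 0" "4 ^ (k - 1) \<le> card V"
  obtains i A where "A \<subseteq> V" "card A = k" "color_clique c i A"
proof -
  have "2 ^ ((k - 1) + (k - 1)) = (4::nat) ^ (k - 1)"
    by (simp add: power_add power_mult_distrib[symmetric])
  then show ?thesis
    using ramsey_two_power_aux[of V "\<lambda>_. k - 1" c] assms that by auto
qed

section \<open>Members of the family from two cliques\<close>

text \<open>Color \<open>a\<close> does not occur between \<open>A\<close> and \<open>B\<close>, so
  its edges are those inside \<open>A\<close>, together with those inside \<open>B\<close> exactly
  when \<open>b = a\<close>: two disjoint cliques in that case, one clique otherwise.\<close>

lemma in_family_Un:
  assumes fin: "finite A" "finite B" and "A \<inter> B = {}" "card A = k" "card B = k"
    and A: "color_clique c a A" and B: "color_clique c b B"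
    and cross: "\<And>x y. x \<in> A \<Longrightarrow> y \<in> B \<Longrightarrow> c {x, y} \<noteq> a"
  shows "in_family k (A \<union> B) c"
proof -
  have cross': "c {y, x} \<noteq> a" if "x \<in> A" "y \<in> B" for x y
    using cross[OF that] by (simp add: insert_commute)
  have "A \<union> B - A = B" using assms by blast
  moreover have "color_class c a (A \<union> B) = (if b = a then [A]\<^bsup>2\<^esup> \<union> [B]\<^bsup>2\<^esup> else [A]\<^bsup>2\<^esup>)" (is "?L = ?R")
  proof (rule set_eqI)
    fix e
    show "e \<in> ?L \<longleftrightarrow> e \<in> ?R"
    proof (cases "\<exists>x y. e = {x, y} \<and> x \<noteq> y")
      case True
      then obtain x y where e: "e = {x, y}" "x \<noteq> y" by blast
      show ?thesis
        using A B cross[of x y] cross'[of y x] e \<open>A \<inter> B = {}\<close>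
        by (auto simp: color_class_def color_clique_def)
    next
      case False
      then show ?thesis by (auto simp: color_class_def nsets_2_eq)
    qed
  qed
  moreover have "card (A \<union> B) = 2 * k" using assms by (simp add: card_Un_disjoint)
  ultimately show ?thesis
    unfolding in_family_def using assms by (intro conjI exI[of _ a] exI[of _ A]) auto
qed

section \<open>Dependent random choice\<close>

text \<open>Power mean inequality: by Bernoulli, \<open>d x ^ t\<close> lies above the tangent line
  of the \<open>t\<close>-th power at \<open>a\<close>, and the linear terms have a nonnegative sum
  because the mean of \<open>d\<close> is at least \<open>a\<close>.\<close>

lemma sum_power_ge:
  fixes d :: "'b \<Rightarrow> real"
  assumes "finite V" and d: "\<And>x. x \<in> V \<Longrightarrow> 0 \<le> d x" and "0 < a"
    and sum: "real (card V) * a \<le> (\<Sum>x\<in>V. d x)"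
  shows "real (card V) * a ^ t \<le> (\<Sum>x\<in>V. d x ^ t)"
proof -
  have *: "a ^ t * (1 + real t * (d x / a - 1)) \<le> d x ^ t" if "x \<in> V" for x
  proof -
    have "1 + real t * (d x / a - 1) \<le> (1 + (d x / a - 1)) ^ t"
      using d[OF that] \<open>0 < a\<close> by (intro Bernoulli_inequality) simp
    then have "a ^ t * (1 + real t * (d x / a - 1)) \<le> a ^ t * (d x / a) ^ t"
      using \<open>0 < a\<close> by (intro mult_left_mono) auto
    then show ?thesis using \<open>0 < a\<close> by (simp add: power_divide)
  qed
  have "real (card V) \<le> (\<Sum>x\<in>V. d x) / a"
    using sum \<open>0 < a\<close> by (simp add: field_simps)
  then have "real (card V) \<le> real (card V) + real t * ((\<Sum>x\<in>V. d x) / a - real (card V))"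
    by simp
  also have "\<dots> = (\<Sum>x\<in>V. 1 + real t * (d x / a - 1))"
    by (simp add: sum.distrib sum_subtractf sum_distrib_left[symmetric] sum_divide_distrib[symmetric])
  finally have "a ^ t * real (card V) \<le> (\<Sum>x\<in>V. a ^ t * (1 + real t * (d x / a - 1)))"
    using \<open>0 < a\<close> by (simp add: sum_distrib_left[symmetric])
  also have "\<dots> \<le> (\<Sum>x\<in>V. d x ^ t)" using * by (rule sum_mono)
  finally show ?thesis by (simp add: mult.commute)
qed

lemma sum_card_filter_swap:
  assumes "finite A" "finite B"
  shows "(\<Sum>x\<in>A. card {y \<in> B. R x y}) = (\<Sum>y\<in>B. card {x \<in> A. R x y})"
  using assms by (intro sum_multicount_gen) auto

text \<open>
  Averaging over all lists of \<open>t\<close> elements of \<open>A\<close>: the common neighborhood of such a list has on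
  average at least \<open>card V * p ^ t\<close> elements, and contains on average at most
  \<open>card V ^ k * (s / card A) ^ t\<close> of the \<open>k\<close>-sets with fewer than \<open>s\<close> common neighbors. Deleting one
  element of each of these from the best common neighborhood gives \<open>U\<close>.
\<close>

lemma dependent_random_choice:
  fixes E :: "'a \<Rightarrow> 'b \<Rightarrow> bool" and p s M :: real
  assumes fin: "finite A" "finite V" and "A \<noteq> {}" "0 < p" "0 \<le> s" "0 < k"
    and deg: "\<And>a. a \<in> A \<Longrightarrow> p * real (card V) \<le> real (card {x \<in> V. E a x})"
    and bound: "M + real (card V) ^ k * (s / real (card A)) ^ t \<le> real (card V) * p ^ t"
  obtains U where "U \<subseteq> V" "M \<le> real (card U)"
    "\<And>X. X \<subseteq> U \<Longrightarrow> card X = k \<Longrightarrow> s \<le> real (card {a \<in> A. \<forall>x\<in>X. E a x})"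
proof -
  define N where "N = real (card A)"
  have N: "N > 0" using fin \<open>A \<noteq> {}\<close> by (auto simp: N_def card_gt_0_iff)
  define com where "com X = {a \<in> A. \<forall>x\<in>X. E a x}" for X
  define Ts where "Ts = {T. set T \<subseteq> A \<and> length T = t}"
  define U where "U T = {x \<in> V. \<forall>a\<in>set T. E a x}" for T
  define Bad where "Bad = {X \<in> Pow V. card X = k \<and> real (card (com X)) < s}"
  define B where "B T = {X \<in> Bad. X \<subseteq> U T}" for T
  have finTs: "finite Ts" unfolding Ts_def using fin by (intro finite_lists_length_eq)
  have cardTs: "real (card Ts) = N ^ t"
    unfolding Ts_def N_def using fin by (simp add: card_lists_length_eq)
  have finBad: "finite Bad" unfolding Bad_def using fin by simp
  have cardBad: "real (card Bad) \<le> real (card V) ^ k"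
  proof -
    have "card Bad \<le> card {X. X \<subseteq> V \<and> card X = k}"
      unfolding Bad_def using fin by (intro card_mono) auto
    also have "\<dots> = card V choose k" using fin by (simp add: n_subsets)
    also have "\<dots> \<le> card V ^ k"
      by (cases "k \<le> card V") (auto intro: binomial_le_pow simp: binomial_eq_0)
    finally show ?thesis by (metis of_nat_le_iff of_nat_power)
  qed
  \<comment> \<open>\<open>X\<close> lies in the common neighborhood of a list iff every entry of
    the list is a common neighbor of \<open>X\<close>. Both sums over \<open>Ts\<close> below rest
    on this.\<close>
  have lists: "card {T \<in> Ts. X \<subseteq> U T} = card (com X) ^ t" if "X \<subseteq> V" for X
  proof -
    have "{T \<in> Ts. X \<subseteq> U T} = {T. set T \<subseteq> com X \<and> length T = t}"
      using that by (auto simp: Ts_def U_def com_def)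
    then show ?thesis using fin by (simp add: card_lists_length_eq com_def)
  qed
  have "N * p * real (card V) \<le> (\<Sum>a\<in>A. real (card {x \<in> V. E a x}))"
    using sum_bounded_below[of A "p * real (card V)" "\<lambda>a. real (card {x \<in> V. E a x})"] deg
    by (simp add: N_def mult_ac)
  also have "\<dots> = real (\<Sum>x\<in>V. card (com {x}))"
    using sum_card_filter_swap[OF fin, of E] by (simp add: com_def flip: of_nat_sum)
  \<comment> \<open>A vertex of \<open>V\<close> has on average at least \<open>N * p\<close>
    neighbors in \<open>A\<close>; convexity carries this over to \<open>t\<close>-th
    powers.\<close>
  finally have "real (card V) * (N * p) ^ t \<le> (\<Sum>x\<in>V. real (card (com {x})) ^ t)"
    using fin N \<open>0 < p\<close> by (intro sum_power_ge) (auto simp: mult_ac)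
  also have "\<dots> = real (\<Sum>x\<in>V. card {T \<in> Ts. {x} \<subseteq> U T})"
    using lists[of "{_}"] by simp
  also have "\<dots> = real (\<Sum>T\<in>Ts. card (U T))"
    using sum_card_filter_swap[OF finTs fin(2), of "\<lambda>T x. {x} \<subseteq> U T"]
    by (simp add: U_def)
  finally have sumU: "real (card V) * (N * p) ^ t \<le> (\<Sum>T\<in>Ts. real (card (U T)))" by simp
  have "(\<Sum>T\<in>Ts. card (B T)) = (\<Sum>X\<in>Bad. card {T \<in> Ts. X \<subseteq> U T})"
    unfolding B_def using finTs finBad by (rule sum_card_filter_swap)
  also have "\<dots> = (\<Sum>X\<in>Bad. card (com X) ^ t)"
    by (intro sum.cong refl lists) (auto simp: Bad_def)
  finally have "(\<Sum>T\<in>Ts. real (card (B T))) = (\<Sum>X\<in>Bad. real (card (com X)) ^ t)"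
    by (simp flip: of_nat_sum of_nat_power)
  also have "\<dots> \<le> real (card Bad) * s ^ t"
    by (rule sum_bounded_above) (auto simp: Bad_def intro!: power_mono)
  also have "\<dots> \<le> real (card V) ^ k * s ^ t"
    using cardBad \<open>0 \<le> s\<close> by (intro mult_right_mono) auto
  finally have sumB: "(\<Sum>T\<in>Ts. real (card (B T))) \<le> real (card V) ^ k * s ^ t" .
  have "N ^ t * (M + real (card V) ^ k * (s / N) ^ t) \<le> N ^ t * (real (card V) * p ^ t)"
    using bound N by (intro mult_left_mono) (auto simp: N_def)
  then have "N ^ t * M + real (card V) ^ k * s ^ t \<le> real (card V) * (N * p) ^ t"
    using N by (simp add: algebra_simps power_divide power_mult_distrib)
  with sumU sumB have "(\<Sum>T\<in>Ts. M) \<le> (\<Sum>T\<in>Ts. real (card (U T)) - real (card (B T)))"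
    by (simp add: cardTs sum_subtractf)
  moreover have "Ts \<noteq> {}" using cardTs N by force
  ultimately obtain T where T: "M \<le> real (card (U T)) - real (card (B T))"
    using sum_strict_mono[OF finTs, of "\<lambda>T. real (card (U T)) - real (card (B T))" "\<lambda>_. M"]
    by (meson leD leI)
  define D where "D = (\<lambda>X. SOME x. x \<in> X) ` B T"
  \<comment> \<open>A bad set has \<open>k > 0\<close> elements, so the chosen element really lies
    in it, and deleting that element destroys the set.\<close>
  have D: "(SOME x. x \<in> X) \<in> X" if "X \<in> B T" for X
  proof -
    have "X \<noteq> {}" using that \<open>0 < k\<close> by (auto simp: B_def Bad_def)
    then show ?thesis by (simp add: some_in_eq)
  qed
  have finB: "finite (B T)" unfolding B_def using finBad by simp
  have "card D \<le> card (B T)" unfolding D_def using finB by (rule card_image_le)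
  moreover have "card (U T) - card D \<le> card (U T - D)"
    using finB by (intro diff_card_le_card_Diff) (simp add: D_def)
  ultimately have "M \<le> real (card (U T - D))" using T by linarith
  moreover have "s \<le> real (card (com X))" if "X \<subseteq> U T - D" "card X = k" for X
  proof (rule ccontr)
    assume "\<not> s \<le> real (card (com X))"
    then have "X \<in> B T" using that by (auto simp: B_def Bad_def U_def)
    with D[OF this] that(1) show False by (auto simp: D_def)
  qed
  ultimately show thesis
    using that[of "U T - D"] by (auto simp: U_def com_def)
qed

section \<open>Degrees and balanced vertices\<close>

text \<open>Double counting: each edge of color \<open>i\<close> is seen from both of its
  ends.\<close>

lemma sum_card_nbhd:
  assumes "finite V"
  shows "(\<Sum>v\<in>V. card (nbhd c V i v)) = 2 * card (color_class c i V)"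
proof -
  have fin: "finite (color_class c i V)"
    using assms by (simp add: color_class_def finite_imp_finite_nsets)
  have "card (nbhd c V i v) = card {e \<in> color_class c i V. v \<in> e}" if "v \<in> V" for v
  proof (rule bij_betw_same_card)
    show "bij_betw (\<lambda>x. {v, x}) (nbhd c V i v) {e \<in> color_class c i V. v \<in> e}"
      unfolding bij_betw_def
    proof
      show "inj_on (\<lambda>x. {v, x}) (nbhd c V i v)" by (auto simp: inj_on_def doubleton_eq_iff)
      show "(\<lambda>x. {v, x}) ` nbhd c V i v = {e \<in> color_class c i V. v \<in> e}"
        using that by (auto simp: nbhd_def color_class_def nsets_2_eq insert_commute)
    qed
  qed
  then have "(\<Sum>v\<in>V. card (nbhd c V i v)) = (\<Sum>v\<in>V. card {e \<in> color_class c i V. v \<in> e})"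
    by (rule sum.cong[OF refl])
  also have "\<dots> = (\<Sum>e\<in>color_class c i V. card {v \<in> V. v \<in> e})"
    using assms fin by (rule sum_card_filter_swap)
  also have "\<dots> = (\<Sum>e\<in>color_class c i V. 2)"
  proof (rule sum.cong[OF refl])
    fix e assume "e \<in> color_class c i V"
    then have "e \<subseteq> V" "card e = 2" by (auto simp: color_class_def nsets_def)
    then show "card {v \<in> V. v \<in> e} = 2" by (metis Int_absorb1 Int_def)
  qed
  finally show ?thesis by simp
qed

lemma card_color_classes:
  assumes "finite V"
  shows "card (color_class c True V) + card (color_class c False V) = card V choose 2"
proof -
  have fin: "finite (color_class c i V)" for i
    using assms by (simp add: color_class_def finite_imp_finite_nsets)
  have "card (color_class c True V) + card (color_class c False V)
      = card (color_class c True V \<union> color_class c False V)"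
    by (intro card_Un_disjoint[symmetric] fin) (auto simp: color_class_def)
  also have "color_class c True V \<union> color_class c False V = [V]\<^bsup>2\<^esup>"
    by (auto simp: color_class_def)
  finally show ?thesis by simp
qed

text \<open>
  Every vertex either has small degree in some color \<open>i\<close> (the set \<open>Z i\<close> below) or is balanced (\<open>H i\<close>).
  An edge between \<open>Z True\<close> and \<open>Z False\<close> has a color in which one of its ends has small degree, so
  one of the two sets is small; if few vertices were balanced, then one color would be too sparse.
\<close>

lemma balanced_vertices:
  fixes \<epsilon> :: real
  assumes fin: "finite V" and n: "16 \<le> card V" and \<epsilon>: "0 < \<epsilon>" "\<epsilon> \<le> 1 / 2"
    and dense: "\<And>i. \<epsilon> * real (card V choose 2) \<le> real (card (color_class c i V))"
  obtains i Q where "Q \<subseteq> V" "\<epsilon> / 8 * real (card V) \<le> real (card Q)"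
    "\<And>v. v \<in> Q \<Longrightarrow> \<epsilon> / 8 * real (card V) \<le> real (card (nbhd c V i v))"
    "\<And>v. v \<in> Q \<Longrightarrow> 2 * card (nbhd c V i v) \<le> card V"
proof -
  define n where "n = real (card V)"
  define b where "b = \<epsilon> / 8 * n"
  define deg where "deg i v = card (nbhd c V i v)" for i v
  define Z where "Z i = {v \<in> V. real (deg i v) < b}" for i
  define H where "H i = {v \<in> V. b \<le> real (deg i v) \<and> 2 * deg i v \<le> card V}" for i
  have n16: "16 \<le> n" using n by (simp add: n_def)
  have b: "0 < b" "b \<le> n / 16"
    using \<epsilon> n16 by (auto simp: b_def)
  have finite: "finite (Z i)" "finite (H i)" for i using fin by (auto simp: Z_def H_def)
  have deg_add: "deg i v + deg (\<not> i) v + 1 = card V" if "v \<in> V" for i v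
    using card_nbhd_add[OF fin that] by (simp add: deg_def)
  have "\<exists>i. b \<le> real (card (H i))"
  proof (rule ccontr)
    assume "\<not> ?thesis"
    then have H: "real (card (H i)) < b" for i by (simp add: not_le)
    \<comment> \<open>The two degrees of a vertex sum to \<open>n - 1\<close>, so one of them is at
      most \<open>n / 2\<close>; its color puts the vertex into \<open>Z\<close> or
      \<open>H\<close>.\<close>
    have V: "V \<subseteq> Z i \<union> Z (\<not> i) \<union> H i \<union> H (\<not> i)" for i
    proof
      fix v assume "v \<in> V"
      with deg_add[OF this, of i] show "v \<in> Z i \<union> Z (\<not> i) \<union> H i \<union> H (\<not> i)"
        unfolding Z_def H_def by auto
    qed
    have Z_disj: "Z i \<inter> Z (\<not> i) = {}" for i
    proof -
      have False if "v \<in> Z i" "v \<in> Z (\<not> i)" for v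
      proof -
        from that deg_add[of v i] have "n < b + b + 1" by (auto simp: Z_def n_def)
        with b n16 show False by linarith
      qed
      then show ?thesis by blast
    qed
    have prod: "real (card (Z i)) * real (card (Z (\<not> i))) \<le> b * (real (card (Z i)) + real (card (Z (\<not> i))))" for i
    proof -
      let ?P = "Sigma (Z i) (nbhd c V i)" and ?Q = "Sigma (Z (\<not> i)) (nbhd c V (\<not> i))"
      \<comment> \<open>An edge of color \<open>i\<close> is counted at its end in
        \<open>Z i\<close>, one of the other color at its end in \<open>Z (\<not> i)\<close>, whence
        the swap.\<close>
      have sub: "Z i \<times> Z (\<not> i) \<subseteq> ?P \<union> prod.swap ` ?Q"
      proof (rule subrelI)
        fix x y assume "(x, y) \<in> Z i \<times> Z (\<not> i)"
        show "(x, y) \<in> ?P \<union> prod.swap ` ?Q"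
        proof (rule ccontr)
          assume "(x, y) \<notin> ?P \<union> prod.swap ` ?Q"
          with \<open>(x, y) \<in> _\<close> have xy: "x \<in> Z i" "y \<in> Z (\<not> i)" "y \<notin> nbhd c V i x" "x \<notin> nbhd c V (\<not> i) y"
            by (auto simp: image_iff)
          moreover have "x \<noteq> y" using Z_disj xy by blast
          ultimately show False
            by (auto simp: Z_def nbhd_def insert_commute)
        qed
      qed
      have fs: "finite (nbhd c V i v)" for i v using fin by simp
      have *: "real (card (Sigma (Z i) (nbhd c V i))) \<le> real (card (Z i)) * b" for i
      proof -
        have "real (card (Sigma (Z i) (nbhd c V i))) = (\<Sum>v\<in>Z i. real (deg i v))"
          using finite fs by (simp add: deg_def)
        also have "\<dots> \<le> real (card (Z i)) * b"
          by (rule sum_bounded_above) (auto simp: Z_def)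
        finally show ?thesis .
      qed
      have "card (Z i \<times> Z (\<not> i)) \<le> card (?P \<union> prod.swap ` ?Q)"
        using sub finite fs by (intro card_mono finite_UnI finite_imageI finite_SigmaI) auto
      also have "\<dots> \<le> card ?P + card (prod.swap ` ?Q)" by (rule card_Un_le)
      also have "\<dots> \<le> card ?P + card ?Q"
        using finite fs by (intro add_left_mono card_image_le finite_SigmaI) auto
      finally have "real (card (Z i \<times> Z (\<not> i))) \<le> real (card ?P) + real (card ?Q)" by linarith
      then show ?thesis
        using *[of i] *[of "\<not> i"] by (simp add: card_cartesian_product algebra_simps)
    qed
    \<comment> \<open>The larger of the two sets determines the color that turns out too
      sparse.\<close>
    have False if le: "card (Z (\<not> i)) \<le> card (Z i)" for i
    proof -
      define w z where "w = real (card (Z i))" and "z = real (card (Z (\<not> i)))"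
      have cardV: "n \<le> w + z + 2 * b"
      proof -
        have "card V \<le> card (Z i \<union> Z (\<not> i) \<union> H i \<union> H (\<not> i))"
          using finite by (intro card_mono V) auto
        also have "\<dots> \<le> card (Z i) + card (Z (\<not> i)) + card (H i) + card (H (\<not> i))"
          by (meson add_le_mono1 card_Un_le le_trans)
        finally show ?thesis using H[of i] H[of "\<not> i"] by (simp add: n_def w_def z_def)
      qed
      have zw: "0 \<le> z" "z \<le> w" "z * w \<le> b * (z + w)"
        using le prod[of i] by (auto simp: w_def z_def algebra_simps)
      \<comment> \<open>From \<open>n \<le> 2 * w + 2 * b\<close> and \<open>b \<le> n / 16\<close>.
        Hence \<open>w \<ge> 7 * b\<close>, that is \<open>w \<le> 7 / 6 * (w - b)\<close>, the
        source of \<open>7 / 6\<close> below.\<close>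
      have w: "7 / 16 * n \<le> w" using cardV zw b by linarith
      have z: "z \<le> 7 / 6 * b"
      proof -
        have "z * (w - b) \<le> b * w" using zw by (simp add: algebra_simps)
        also have "\<dots> \<le> b * (7 / 6 * (w - b))" using w b by (intro mult_left_mono) auto
        finally have "z * (w - b) \<le> (7 / 6 * b) * (w - b)" by (simp add: algebra_simps)
        moreover have "0 < w - b" using w b n16 by linarith
        ultimately show ?thesis by (simp add: mult_le_cancel_right)
      qed
      have ub: "real (deg i v) \<le> (if v \<in> Z i then b else 0) + (if v \<in> Z (\<not> i) then n else 0)
           + (if v \<in> H i then n / 2 else 0) + (if v \<in> H (\<not> i) then n else 0)" if "v \<in> V" for v
      proof -
        have "real (deg i v) \<le> n" using deg_add[OF that, of i] by (simp add: n_def)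
        moreover have "real (deg i v) \<le> n / 2" if "v \<in> H i"
          using that by (auto simp: H_def n_def)
        moreover have "real (deg i v) \<le> b" if "v \<in> Z i" using that by (auto simp: Z_def)
        ultimately show ?thesis using V[of i] that b n16 by (auto simp del: of_nat_le_iff)
      qed
      have sum_if: "(\<Sum>v\<in>V. if v \<in> S then t else 0) = real (card S) * t"
        if "S \<subseteq> V" for S and t :: real
        using that fin by (simp add: sum.If_cases Int_absorb1)
      have sub: "Z j \<subseteq> V" "H j \<subseteq> V" for j by (auto simp: Z_def H_def)
      have "(\<Sum>v\<in>V. real (deg i v)) \<le> (\<Sum>v\<in>V. (if v \<in> Z i then b else 0) + (if v \<in> Z (\<not> i) then n else 0)
           + (if v \<in> H i then n / 2 else 0) + (if v \<in> H (\<not> i) then n else 0))"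
        by (rule sum_mono) (rule ub)
      also have "\<dots> = w * b + z * n + real (card (H i)) * (n / 2) + real (card (H (\<not> i))) * n"
        using sub by (simp only: sum.distrib sum_if w_def z_def)
      also have "\<dots> \<le> n * b + (7 / 6 * b) * n + b * (n / 2) + b * n"
      proof (intro add_mono mult_right_mono)
        show "w \<le> n" unfolding w_def n_def using fin sub by (simp add: card_mono)
      qed (use z H[of i] H[of "\<not> i"] b n16 in auto)
      \<comment> \<open>The coefficients sum to \<open>11 / 3\<close>, below 4. The divisor 8 in
        \<open>b\<close> makes \<open>4 * b * n\<close> half of \<open>\<epsilon> * n * n\<close>,
        which is less than the degree sum that the density demands.\<close>
      also have "\<dots> \<le> 4 * b * n" using b n16 by (simp add: algebra_simps)
      also have "\<dots> = \<epsilon> * n * (n / 2)" by (simp add: b_def)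
      also have "\<dots> < \<epsilon> * n * (n - 1)" using \<epsilon> n16 by (intro mult_strict_left_mono) auto
      also have "\<dots> = 2 * (\<epsilon> * real (card V choose 2))"
      proof -
        have "2 * (card V choose 2) = card V * (card V - 1)"
          unfolding choose_two by (rule dvd_mult_div_cancel) (cases "card V"; simp)
        then have "2 * real (card V choose 2) = real (card V * (card V - 1))"
          by (metis of_nat_mult of_nat_numeral)
        also have "\<dots> = n * (n - 1)" using n by (simp add: n_def of_nat_diff)
        finally show ?thesis by (simp add: mult.left_commute mult.assoc)
      qed
      also have "\<dots> \<le> real (2 * card (color_class c i V))" using dense[of i] by simp
      also have "\<dots> = (\<Sum>v\<in>V. real (deg i v))"
        using sum_card_nbhd[OF fin, of c i] by (simp add: deg_def flip: of_nat_sum)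
      finally show False by simp
    qed
    from this[of True] this[of False] show False by simp linarith
  qed
  then obtain i where i: "b \<le> real (card (H i))" ..
  show thesis
  proof (rule that)
    show "H i \<subseteq> V" by (auto simp: H_def)
    show "\<epsilon> / 8 * real (card V) \<le> real (card (H i))" using i by (simp only: b_def n_def)
  next
    fix v assume "v \<in> H i"
    then show "\<epsilon> / 8 * real (card V) \<le> real (card (nbhd c V i v))"
      and "2 * card (nbhd c V i v) \<le> card V"
      by (simp_all only: H_def deg_def b_def n_def mem_Collect_eq)
  qed
qed

section \<open>Numerical estimates\<close>

lemma power2_of_power: "(x ^ m)\<^sup>2 = (x\<^sup>2) ^ m" for x :: "'a::monoid_mult"
  by (simp only: power_mult[symmetric] mult.commute)

text \<open>The first bound, from \<open>16 / \<epsilon> \<ge> 32\<close>, serves the first random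
  choice. The other two serve the second: one makes its main term large, through
  \<open>16 / \<epsilon> * (\<epsilon> / 8) = 2\<close>, the other makes its bad sets few.\<close>

lemma size_bounds:
  fixes n \<epsilon> :: real
  assumes "0 < k" "0 < \<epsilon>" "\<epsilon> \<le> 1 / 2" and n: "(16 / \<epsilon>) ^ (2 * k + 1) \<le> n"
  shows "32 * 1024 ^ k \<le> n"
    and "32 * 4 ^ k \<le> n * (\<epsilon> / 8) ^ (2 * k)"
    and "32 * 256 ^ k \<le> n * \<epsilon>\<^sup>2"
proof -
  have "(32::real) ^ (2 * k + 1) \<le> (16 / \<epsilon>) ^ (2 * k + 1)"
    using assms by (intro power_mono) (auto simp: field_simps)
  with n show "32 * 1024 ^ k \<le> n" by (simp add: power_mult)
  have "32 * 4 ^ k \<le> 16 / \<epsilon> * 4 ^ k" using assms by (intro mult_right_mono) (auto simp: field_simps)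
  also have "\<dots> = 16 / \<epsilon> * (16 / \<epsilon> * (\<epsilon> / 8)) ^ (2 * k)" using assms by (simp add: power_mult)
  also have "\<dots> = (16 / \<epsilon>) ^ (2 * k + 1) * (\<epsilon> / 8) ^ (2 * k)"
    by (simp only: power_mult_distrib power_add power_one_right mult_ac)
  also have "\<dots> \<le> n * (\<epsilon> / 8) ^ (2 * k)" using n assms by (intro mult_right_mono) auto
  finally show "32 * 4 ^ k \<le> n * (\<epsilon> / 8) ^ (2 * k)" .
  have "\<epsilon> ^ (2 * k + 1) \<le> \<epsilon> ^ 3" using assms by (intro power_decreasing) auto
  also have "\<dots> = \<epsilon> * \<epsilon>\<^sup>2" by (simp add: power3_eq_cube power2_eq_square)
  also have "\<dots> \<le> 1 / 2 * \<epsilon>\<^sup>2" using assms by (intro mult_right_mono) auto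
  finally have "2 * \<epsilon> ^ (2 * k + 1) \<le> \<epsilon>\<^sup>2" by simp
  then have "16 * 256 ^ k * (2 * \<epsilon> ^ (2 * k + 1)) \<le> 16 * 256 ^ k * \<epsilon>\<^sup>2"
    by (intro mult_left_mono) auto
  moreover have "(16 / \<epsilon>) ^ (2 * k + 1) * \<epsilon>\<^sup>2 = 16 * 256 ^ k * \<epsilon>\<^sup>2 / \<epsilon> ^ (2 * k + 1)"
    by (simp add: power_divide power_mult)
  moreover have "0 < \<epsilon> ^ (2 * k + 1)" using assms by simp
  ultimately have "32 * 256 ^ k \<le> (16 / \<epsilon>) ^ (2 * k + 1) * \<epsilon>\<^sup>2"
    by (simp only: pos_le_divide_eq)
  also have "\<dots> \<le> n * \<epsilon>\<^sup>2" using n by (intro mult_right_mono) auto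
  finally show "32 * 256 ^ k \<le> n * \<epsilon>\<^sup>2" .
qed

text \<open>The bad-set term equals \<open>(n / 4 ^ t) ^ k\<close>, which is at most 1 once
  \<open>4 ^ t \<ge> n\<close>. For the least such \<open>t\<close> also
  \<open>4 ^ t \<le> 4 * n\<close>, so the main term \<open>n / 2 ^ t\<close> is at least
  \<open>2 ^ t / 4\<close>, hence at least \<open>32 ^ k\<close>.\<close>

lemma first_choice_bound:
  fixes n q :: real
  assumes k: "0 < k" and n: "32 * 1024 ^ k \<le> n" and "0 < q"
  obtains t where "4 ^ k + n ^ k * (q / 4 ^ k / q) ^ t \<le> n * (1 / 2) ^ t"
proof -
  define t where "t = (LEAST t. n \<le> 4 ^ t)"
  have "1 \<le> (1024::real) ^ k" by simp
  with n have n32: "32 \<le> n" by linarith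
  have ex: "\<exists>t. n \<le> 4 ^ t" using real_arch_pow[of 4 n] by (auto intro: less_imp_le)
  then have t: "n \<le> 4 ^ t" unfolding t_def by (rule LeastI_ex)
  then have "t \<noteq> 0" using n32 by (intro notI) simp
  then obtain u where u: "t = Suc u" using not0_implies_Suc by blast
  have "\<not> n \<le> 4 ^ u" using not_less_Least[of u "\<lambda>t. n \<le> 4 ^ t"] u by (simp add: t_def)
  then have t': "4 ^ t \<le> 4 * n" using u by simp
  have sq: "(2 ^ t)\<^sup>2 = (4::real) ^ t" by (simp add: power2_of_power)
  have "(4 * 32 ^ k)\<^sup>2 = 16 * (1024::real) ^ k" by (simp add: power_mult_distrib power2_of_power)
  also have "\<dots> \<le> 32 * 1024 ^ k" by simp
  also have "\<dots> \<le> (2 ^ t)\<^sup>2" using n t sq by linarith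
  finally have y: "4 * 32 ^ k \<le> (2::real) ^ t" by (rule power2_le_imp_le) simp
  have "8 ^ 1 \<le> (8::real) ^ k" using k by (intro power_increasing) auto
  then have "8 * 4 ^ k \<le> (8::real) ^ k * 4 ^ k" by (intro mult_right_mono) auto
  also have "\<dots> = 32 ^ k" by (simp flip: power_mult_distrib)
  finally have "8 * 4 ^ k \<le> (32::real) ^ k" .
  moreover have "1 \<le> (4::real) ^ k" by simp
  ultimately have "4 ^ k + 1 \<le> (32::real) ^ k" by linarith
  also have "\<dots> \<le> 2 ^ t / 4" using y by simp
  also have "\<dots> = (2 ^ t)\<^sup>2 / 4 / 2 ^ t" by (simp add: power2_eq_square)
  also have "\<dots> \<le> n / 2 ^ t" using t' sq by (intro divide_right_mono) auto
  finally have 1: "4 ^ k + 1 \<le> n * (1 / 2) ^ t" by (simp add: power_one_over)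
  have "n ^ k * (q / 4 ^ k / q) ^ t = (n / 4 ^ t) ^ k"
    using \<open>0 < q\<close> by (simp add: power_divide mult.commute flip: power_mult)
  also have "\<dots> \<le> 1" using t n32 by (intro power_le_one) auto
  finally show thesis using 1 that[of t] by linarith
qed

text \<open>With sample size \<open>2 * k\<close> the bad-set term is the \<open>k\<close>-th power
  of \<open>n * (4 ^ k / a)\<^sup>2\<close>, which is at most 2. So that term is at most
  \<open>4 ^ k\<close>, and the right-hand side has room for both summands.\<close>

lemma second_choice_bound:
  fixes n a \<epsilon> :: real
  assumes "0 < n" "0 < \<epsilon>" and a: "\<epsilon> / 8 * n / 4 ^ k \<le> a"
    and n1: "32 * 4 ^ k \<le> n * (\<epsilon> / 8) ^ (2 * k)" and n2: "32 * 256 ^ k \<le> n * \<epsilon>\<^sup>2"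
  shows "4 ^ k + n ^ k * (4 ^ k / a) ^ (2 * k) \<le> n * (\<epsilon> / 8) ^ (2 * k)"
proof -
  have pos: "0 < \<epsilon> / 8 * n / 4 ^ k" using assms by simp
  have "4 ^ k / a \<le> 4 ^ k / (\<epsilon> / 8 * n / 4 ^ k)"
    using a pos by (intro divide_left_mono mult_pos_pos) (auto intro: less_le_trans)
  then have "(4 ^ k / a)\<^sup>2 \<le> (4 ^ k / (\<epsilon> / 8 * n / 4 ^ k))\<^sup>2"
    using a pos by (intro power_mono) auto
  also have "4 ^ k / (\<epsilon> / 8 * n / 4 ^ k) = 8 * 16 ^ k / (\<epsilon> * n)"
    by (simp add: field_simps flip: power_mult_distrib)
  also have "(8 * 16 ^ k / (\<epsilon> * n))\<^sup>2 = 64 * 256 ^ k / (\<epsilon>\<^sup>2 * n\<^sup>2)"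
    
    by (simp add: power_divide power_mult_distrib power2_of_power)
  finally have "n * (4 ^ k / a)\<^sup>2 \<le> n * (64 * 256 ^ k / (\<epsilon>\<^sup>2 * n\<^sup>2))"
    using assms by (intro mult_left_mono) auto
  also have "\<dots> = 64 * 256 ^ k / (n * \<epsilon>\<^sup>2)" using assms by (simp add: power2_eq_square)
  also have "\<dots> \<le> 2" using n2 assms by (simp add: field_simps)
  finally have "(n * (4 ^ k / a)\<^sup>2) ^ k \<le> 2 ^ k" using assms by (intro power_mono) auto
  also have "\<dots> \<le> (4::real) ^ k" by (intro power_mono) auto
  finally have "n ^ k * (4 ^ k / a) ^ (2 * k) \<le> 4 ^ k" by (simp only: power_mult_distrib power_mult)
  moreover have "0 \<le> (4::real) ^ k" by simp
  ultimately show ?thesis using n1 by linarith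
qed

section \<open>The two random choices combined\<close>

theorem theorem1p1:
  fixes k n :: nat and \<epsilon> :: real and V :: "'a set" and c :: "'a set \<Rightarrow> bool"
  assumes "k > 0" and "\<epsilon> > 0"
    and "n \<ge> 2"
    and "real n \<ge> (16 / \<epsilon>) ^ (2 * k + 1)"
    and "finite V" and "card V = n"
    and "\<And>i. real (card (color_class c i V)) \<ge> \<epsilon> * real (n choose 2)"
  shows "contains_member k V c"
proof -
  \<comment> \<open>Since there are edges, both colors having an \<open>\<epsilon>\<close> fraction
    of them forces \<open>\<epsilon> \<le> 1 / 2\<close>.\<close>
  have "0 < n choose 2" using \<open>n \<ge> 2\<close> by (simp add: zero_less_binomial)
  moreover have "2 * (\<epsilon> * real (n choose 2)) \<le> real (n choose 2)"
    using card_color_classes[OF \<open>finite V\<close>, of c] assms(7)[of True] assms(7)[of False]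
    unfolding \<open>card V = n\<close> by linarith
  ultimately have \<epsilon>: "\<epsilon> \<le> 1 / 2" by (simp add: mult.assoc[symmetric])
  note bounds = size_bounds[OF assms(1,2) \<epsilon> assms(4)]
  have "1 \<le> (1024::real) ^ k" by simp
  with bounds(1) have "16 \<le> n" by linarith
  then obtain i Q where Q: "Q \<subseteq> V" "\<epsilon> / 8 * real n \<le> real (card Q)"
    "\<And>v. v \<in> Q \<Longrightarrow> \<epsilon> / 8 * real n \<le> real (card (nbhd c V i v))"
    "\<And>v. v \<in> Q \<Longrightarrow> 2 * card (nbhd c V i v) \<le> n"
    using balanced_vertices[OF \<open>finite V\<close> _ \<open>\<epsilon> > 0\<close> \<epsilon>, of c] assms(6,7) by metis
  have finQ: "finite Q" using Q(1) \<open>finite V\<close> by (rule finite_subset)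
  have "0 < \<epsilon> / 8 * real n" using \<open>\<epsilon> > 0\<close> \<open>16 \<le> n\<close> by simp
  with Q(2) have "0 < real (card Q)" by linarith
  then have "Q \<noteq> {}" by force
  have pow4: "4 ^ (k - 1) \<le> (4::nat) ^ k" by (intro power_increasing) auto

  \<comment> \<open>A vertex counts as a non-neighbor of itself, so that the density is at least 1/2 without
    an error term; this is why \<open>X\<close> has to be removed from \<open>S'\<close> below.\<close>
  obtain t where "4 ^ k + real (card V) ^ k * (real (card Q) / 4 ^ k / real (card Q)) ^ t
      \<le> real (card V) * (1 / 2) ^ t"
    using first_choice_bound[OF \<open>k > 0\<close> bounds(1) \<open>0 < real (card Q)\<close>] \<open>card V = n\<close> by metis
  moreover have "1 / 2 * real (card V) \<le> real (card {x \<in> V. x \<notin> nbhd c V i v})" if "v \<in> Q" for v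
  proof -
    have "{x \<in> V. x \<notin> nbhd c V i v} = V - nbhd c V i v" by blast
    then have "card {x \<in> V. x \<notin> nbhd c V i v} = n - card (nbhd c V i v)"
      using \<open>finite V\<close> \<open>card V = n\<close> by (simp add: card_Diff_subset nbhd_subset)
    with Q(4)[OF that] \<open>card V = n\<close> show ?thesis by simp
  qed
  ultimately obtain U where U: "U \<subseteq> V" "4 ^ k \<le> real (card U)"
    "\<And>X. X \<subseteq> U \<Longrightarrow> card X = k \<Longrightarrow> real (card Q) / 4 ^ k \<le> real (card {a \<in> Q. \<forall>x\<in>X. x \<notin> nbhd c V i a})"
    using dependent_random_choice[OF finQ \<open>finite V\<close> \<open>Q \<noteq> {}\<close>, of "1 / 2" "real (card Q) / 4 ^ k" k
        "\<lambda>v x. x \<notin> nbhd c V i v" "4 ^ k" t] \<open>k > 0\<close> by auto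
  have finU: "finite U" using U(1) \<open>finite V\<close> by (rule finite_subset)
  have "4 ^ k \<le> card U" using U(2) by (metis of_nat_le_iff of_nat_numeral of_nat_power)
  with pow4 have "4 ^ (k - 1) \<le> card U" by linarith
  \<comment> \<open>\<open>X\<close> may have either color, because \<open>in_family_Un\<close>
    leaves the color of the second clique free.\<close>
  then obtain p X where X: "X \<subseteq> U" "card X = k" "color_clique c p X"
    using ramsey_diagonal[OF finU \<open>k > 0\<close>] by metis
  define S where "S = {a \<in> Q. \<forall>x\<in>X. x \<notin> nbhd c V i a}"
  have finS: "finite S" using finQ by (simp add: S_def)
  have "\<epsilon> / 8 * real n / 4 ^ k \<le> real (card Q) / 4 ^ k"
    using Q(2) by (intro divide_right_mono) auto
  with U(3)[OF X(1,2)] have S: "\<epsilon> / 8 * real n / 4 ^ k \<le> real (card S)" by (simp add: S_def)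
  moreover have "0 < \<epsilon> / 8 * real n / 4 ^ k" using \<open>\<epsilon> > 0\<close> \<open>16 \<le> n\<close> by simp
  ultimately have "S \<noteq> {}" by force

  have "4 ^ k + real (card V) ^ k * (4 ^ k / real (card S)) ^ (2 * k) \<le> real (card V) * (\<epsilon> / 8) ^ (2 * k)"
    using second_choice_bound[OF _ \<open>\<epsilon> > 0\<close> S bounds(2,3)] \<open>card V = n\<close> \<open>16 \<le> n\<close> by simp
  moreover have "\<epsilon> / 8 * real (card V) \<le> real (card {x \<in> V. x \<in> nbhd c V i v})" if "v \<in> S" for v
  proof -
    have "{x \<in> V. x \<in> nbhd c V i v} = nbhd c V i v" by (auto simp: nbhd_def)
    then show ?thesis using Q(3)[of v] that \<open>card V = n\<close> by (simp add: S_def)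
  qed
  ultimately obtain U' where U': "U' \<subseteq> V" "4 ^ k \<le> real (card U')"
    "\<And>Y. Y \<subseteq> U' \<Longrightarrow> card Y = k \<Longrightarrow> 4 ^ k \<le> real (card {a \<in> S. \<forall>y\<in>Y. y \<in> nbhd c V i a})"
    using dependent_random_choice[OF finS \<open>finite V\<close> \<open>S \<noteq> {}\<close>, of "\<epsilon> / 8" "4 ^ k" k
        "\<lambda>v x. x \<in> nbhd c V i v" "4 ^ k" "2 * k"] \<open>k > 0\<close> \<open>\<epsilon> > 0\<close> by auto
  have finU': "finite U'" using U'(1) \<open>finite V\<close> by (rule finite_subset)
  have "4 ^ k \<le> card U'" using U'(2) by (metis of_nat_le_iff of_nat_numeral of_nat_power)
  with pow4 have "4 ^ (k - 1) \<le> card U'" by linarith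
  then obtain r Y where Y: "Y \<subseteq> U'" "card Y = k" "color_clique c r Y"
    using ramsey_diagonal[OF finU' \<open>k > 0\<close>] by metis
  define S' where "S' = {a \<in> S. \<forall>y\<in>Y. y \<in> nbhd c V i a}"
  have fin: "finite X" "finite Y" "finite S'"
    using X(1) Y(1) finU finU' finS by (auto simp: S'_def intro: finite_subset)
  have "4 ^ k \<le> card S'"
    using U'(3)[OF Y(1,2)] unfolding S'_def by (metis of_nat_le_iff of_nat_numeral of_nat_power)
  \<comment> \<open>The threshold \<open>4 ^ k\<close> of the second choice leaves room to remove
    the \<open>k\<close> vertices of \<open>X\<close> and still apply Ramsey's theorem.\<close>
  moreover have "4 ^ (k - 1) + k \<le> (4::nat) ^ k"
  proof -
    obtain j where "k = Suc j" using \<open>k > 0\<close> not0_implies_Suc by blast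
    moreover have "Suc j \<le> 3 * 4 ^ j" by (induction j) auto
    ultimately show ?thesis by simp
  qed
  moreover have "card S' - card X \<le> card (S' - X)" using fin by (intro diff_card_le_card_Diff)
  ultimately have "4 ^ (k - 1) \<le> card (S' - X)" using X(2) by linarith
  then obtain s K where K: "K \<subseteq> S' - X" "card K = k" "color_clique c s K"
    using ramsey_diagonal[OF finite_Diff[OF fin(3)] \<open>k > 0\<close>] by metis
  have finK: "finite K" using K(1) fin by (auto intro: finite_subset)
  have "K \<subseteq> V" using K(1) Q(1) by (auto simp: S'_def S_def)
  show ?thesis
  proof (cases "s = i")
    case True
    have "in_family k (K \<union> X) c"
    proof (rule in_family_Un[OF finK fin(1) _ K(2) X(2) K(3) X(3)])
      fix a x assume "a \<in> K" "x \<in> X"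
      moreover from this have "x \<noteq> a" "x \<in> V" "x \<notin> nbhd c V i a"
        using K(1) X(1) U(1) by (auto simp: S'_def S_def)
      ultimately show "c {a, x} \<noteq> s" using True by (simp add: nbhd_def)
    qed (use K(1) in blast)
    then show ?thesis
      unfolding contains_member_def using \<open>K \<subseteq> V\<close> X(1) U(1) by (intro exI[of _ "K \<union> X"]) auto
  next
    case False
    have KY: "y \<in> nbhd c V i a" if "a \<in> K" "y \<in> Y" for a y
      using K(1) that by (auto simp: S'_def)
    have "in_family k (K \<union> Y) c"
    proof (rule in_family_Un[OF finK fin(2) _ K(2) Y(2) K(3) Y(3)])
      show "K \<inter> Y = {}" using KY by (auto simp: nbhd_def)
      show "c {a, y} \<noteq> s" if "a \<in> K" "y \<in> Y" for a y
        using KY[OF that] False by (simp add: nbhd_def)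
    qed
    then show ?thesis
      unfolding contains_member_def using \<open>K \<subseteq> V\<close> Y(1) U'(1) by (intro exI[of _ "K \<union> Y"]) auto
  qed
qed

end
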